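(* Let $\Gamma\subseteq\{1,-1\}^n$ and let $C_{n,2d}(\Gamma)=\{p\in C_{n,2d} : p(\mathbf{s})=0 \text{ for all } \mathbf{s}\in\Gamma\}$. (1) If $|\Gamma|=2^n$, then $\dim(C_{n,2d}(\Gamma))\le\binom{n+d}{d}$. (2) If $|\Gamma|=2^{n-1}$, then $\dim(C_{n,2d}(\Gamma))\le\binom{n+2d}{2d}$.
   Context: $\mathbb{N}=\{0,1,2,\dots\}$; $n,d\ge 1$. A circuit polynomial is a polynomial $f(\mathbf{x})=\sum_{j=0}^r f_{\boldsymbol{\alpha}(j)}\mathbf{x}^{\boldsymbol{\alpha}(j)}+f_{\boldsymbol{\beta}}\mathbf{x}^{\boldsymbol{\beta}}\in\mathbb{R}[x_1,\dots,x_n]$ with $r\le n$, $f_{\boldsymbol{\alpha}(j)}>0$, $f_{\boldsymbol{\beta}}\in\mathbb{R}$, such that the Newton polytope of $f$ (convex hull of the exponents with nonzero coefficient) is a simplex with vertices $\boldsymbol{\alpha}(0),\dots,\boldsymbol{\alpha}(r)\in(2\mathbb{N})^n$ and $\boldsymbol{\beta}\in\mathbb{N}^n$ is written uniquely as $\boldsymbol{\beta}=\sum_{j=0}^r\lambda_j\boldsymbol{\alpha}(j)$ with $\lambda_j>0$, $\sum_j\lambda_j=1$. $C_{n,2d}$ is the cone of all finite sums $\sum_i\mu_i f_i$ of degree at most $2d$ with $\mu_i\ge 0$ and $f_i$ nonnegative circuit polynomials. $\dim$ of a face means the dimension of its affine hull. *)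

theory Defs
  imports "HOL-Analysis.Analysis" "HOL-Library.Poly_Mapping"
begin

text \<open>
  A polynomial in \<open>\<real>[x\<^sub>1, \<dots>, x\<^sub>n]\<close>, with \<open>n = CARD('n)\<close>, is a finitely supported map from exponent
  vectors in \<open>\<nat>\<^sup>n\<close> to real coefficients.
\<close>

type_synonym 'n rpoly = "(nat ^ 'n) \<Rightarrow>\<^sub>0 real"

instantiation poly_mapping :: (type, real_vector) real_vector
begin

lift_definition scaleR_poly_mapping :: "real \<Rightarrow> ('a \<Rightarrow>\<^sub>0 'b) \<Rightarrow> ('a \<Rightarrow>\<^sub>0 'b)"
  is "\<lambda>c f a. c *\<^sub>R f a"
proof -
  fix c :: real and f :: "'a \<Rightarrow> 'b"
  assume "finite {a. f a \<noteq> 0}"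
  then show "finite {a. c *\<^sub>R f a \<noteq> 0}"
    by (rule rev_finite_subset) auto
qed

instance
  by standard (transfer; simp add: fun_eq_iff scaleR_add_right scaleR_add_left)+

end

definition poly_eval :: "'n::finite rpoly \<Rightarrow> real ^ 'n \<Rightarrow> real" where
  "poly_eval p x = (\<Sum>a\<in>Poly_Mapping.keys p. Poly_Mapping.lookup p a * (\<Prod>i\<in>UNIV. (x $ i) ^ (a $ i)))"

definition total_degree :: "'n::finite rpoly \<Rightarrow> nat" where
  "total_degree p = Max (insert 0 ((\<lambda>a. \<Sum>i\<in>UNIV. a $ i) ` Poly_Mapping.keys p))"

definition real_exponent :: "nat ^ 'n::finite \<Rightarrow> real ^ 'n" where
  "real_exponent a = (\<chi> i. real (a $ i))"

definition newton_polytope :: "'n::finite rpoly \<Rightarrow> (real ^ 'n) set" where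
  "newton_polytope p = convex hull (real_exponent ` Poly_Mapping.keys p)"

text \<open>
  The barycentric coordinates \<open>\<lambda>\<close> are normalised to vanish beyond \<open>r\<close>, so that their
  uniqueness can be expressed for functions on \<open>\<nat>\<close>. For \<open>r = 0\<close> the definition forces
  \<open>\<beta> = \<alpha>(0)\<close>, so \<open>f\<close> is a single nonzero term.
\<close>

definition circuit_polynomial :: "'n::finite rpoly \<Rightarrow> bool" where
  "circuit_polynomial f \<longleftrightarrow>
     (\<exists>(r::nat) (\<alpha> :: nat \<Rightarrow> nat ^ 'n) (\<beta> :: nat ^ 'n) (c :: nat \<Rightarrow> real) (c\<^sub>\<beta> :: real).
        r \<le> CARD('n) \<and>
        f = (\<Sum>j\<le>r. Poly_Mapping.single (\<alpha> j) (c j)) + Poly_Mapping.single \<beta> c\<^sub>\<beta> \<and>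
        (\<forall>j\<le>r. c j > 0) \<and>
        (\<forall>j\<le>r. \<forall>i. even (\<alpha> j $ i)) \<and>
        int r simplex newton_polytope f \<and>
        {v. v extreme_point_of newton_polytope f} = (\<lambda>j. real_exponent (\<alpha> j)) ` {..r} \<and>
        (\<exists>!l :: nat \<Rightarrow> real.
           (\<forall>j\<le>r. l j > 0) \<and> (\<forall>j>r. l j = 0) \<and> (\<Sum>j\<le>r. l j) = 1 \<and>
           real_exponent \<beta> = (\<Sum>j\<le>r. l j *\<^sub>R real_exponent (\<alpha> j))))"

definition nonneg_polynomial :: "'n::finite rpoly \<Rightarrow> bool" where
  "nonneg_polynomial p \<longleftrightarrow> (\<forall>x. poly_eval p x \<ge> 0)"

text \<open>
  The degree bound applies to the sum, not to the individual summands. The cone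
  \<open>C\<^sub>n\<^sub>,\<^sub>2\<^sub>d\<close> is \<open>sonc_cone (2 * d)\<close>.
\<close>

definition sonc_cone :: "nat \<Rightarrow> 'n::finite rpoly set" where
  "sonc_cone k = {p. total_degree p \<le> k \<and>
     (\<exists>(m::nat) (\<mu> :: nat \<Rightarrow> real) (f :: nat \<Rightarrow> 'n rpoly).
        (\<forall>i<m. \<mu> i \<ge> 0 \<and> circuit_polynomial (f i) \<and> nonneg_polynomial (f i)) \<and>
        p = (\<Sum>i<m. \<mu> i *\<^sub>R f i))}"

definition sonc_face :: "nat \<Rightarrow> (real ^ 'n::finite) set \<Rightarrow> 'n rpoly set" where
  "sonc_face k \<Gamma> = {p \<in> sonc_cone k. \<forall>s\<in>\<Gamma>. poly_eval p s = 0}"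

text \<open>
  The dimension of the affine hull of a nonempty set, that is, of the linear space of its
  differences. The library's \<open>aff_dim\<close> needs a Euclidean space, and \<open>dim\<close> alone
  would return 0 on spaces of infinite dimension; here these get dimension \<open>\<infinity>\<close>.
\<close>

definition affine_hull_dim :: "'a::real_vector set \<Rightarrow> enat" where
  "affine_hull_dim S =
     (let V = {x - y | x y. x \<in> affine hull S \<and> y \<in> affine hull S}
      in if \<exists>B. finite B \<and> V \<subseteq> span B then enat (dim V) else \<infinity>)"

end

theory Submission imports Defs begin

text \<open>
  If a sum of nonnegative circuit polynomials vanishes on \<open>{1, -1}\<^sup>n\<close>, then so does every summand with
  positive weight. At a sign vector \<open>s\<close> such a summand is \<open>\<Sum>\<^sub>j c\<^sub>j + c\<^sub>\<beta> s\<^sup>\<beta>\<close> with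
  \<open>\<Sum>\<^sub>j c\<^sub>j > 0\<close>, so \<open>s\<^sup>\<beta>\<close> is the same for all \<open>s\<close> and \<open>\<beta>\<close> is even. Hence the sum is
  spanned by the monomials of degree at most \<open>2d\<close> with even exponents, of which there are
  \<open>n + d choose d\<close>. The second bound is the dimension of the space of all polynomials of degree
  at most \<open>2d\<close>.
\<close>

section \<open>Polynomials with prescribed support\<close>

text \<open>Adding or scaling creates no new exponents. Closure under linear combinations carries
  support conditions to affine hulls and to sums of circuit polynomials.\<close>

lemma subspace_keys_subset:
  "subspace {p :: 'a \<Rightarrow>\<^sub>0 'b::real_vector. Poly_Mapping.keys p \<subseteq> A}"
proof (rule subspaceI)
  fix p q :: "'a \<Rightarrow>\<^sub>0 'b" and c :: real
  assume p: "p \<in> {p. Poly_Mapping.keys p \<subseteq> A}"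
  then show "c *\<^sub>R p \<in> {p. Poly_Mapping.keys p \<subseteq> A}"
    by (auto simp: subset_iff in_keys_iff scaleR_poly_mapping.rep_eq)
  assume "q \<in> {p. Poly_Mapping.keys p \<subseteq> A}"
  with p show "p + q \<in> {p. Poly_Mapping.keys p \<subseteq> A}"
    using Poly_Mapping.keys_add[of p q] by auto
qed auto

lemma scaleR_single: "c *\<^sub>R Poly_Mapping.single a b = Poly_Mapping.single a (c *\<^sub>R b)"
  by (rule poly_mapping_eqI)
     (simp add: scaleR_poly_mapping.rep_eq lookup_single when_def)

lemma keys_subset_imp_in_span:
  fixes p :: "'a \<Rightarrow>\<^sub>0 real"
  assumes "Poly_Mapping.keys p \<subseteq> A"
  shows "p \<in> span ((\<lambda>a. Poly_Mapping.single a 1) ` A)"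
proof -
  have "p = (\<Sum>a\<in>Poly_Mapping.keys p. Poly_Mapping.single a (Poly_Mapping.lookup p a))"
    by (rule poly_mapping_eqI)
       (auto simp: lookup_sum lookup_single when_def sum.delta' in_keys_iff)
  also have "\<dots> = (\<Sum>a\<in>Poly_Mapping.keys p. Poly_Mapping.lookup p a *\<^sub>R Poly_Mapping.single a 1)"
    by (simp add: scaleR_single)
  also have "\<dots> \<in> span ((\<lambda>a. Poly_Mapping.single a 1) ` A)"
    using assms by (intro span_sum span_scale span_base) auto
  finally show ?thesis .
qed

text \<open>The polynomials supported in \<open>A\<close> form a subspace spanned by the monomials
  with exponents in \<open>A\<close>; it contains \<open>S\<close>, hence its affine hull and all
  differences.\<close>

lemma affine_hull_dim_le_card:
  fixes S :: "('a \<Rightarrow>\<^sub>0 real) set"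
  assumes "finite A" and S: "S \<subseteq> {p. Poly_Mapping.keys p \<subseteq> A}"
  shows "affine_hull_dim S \<le> enat (card A)"
proof -
  define B where "B = (\<lambda>a. Poly_Mapping.single a (1::real)) ` A"
  define V where "V = {x - y | x y. x \<in> affine hull S \<and> y \<in> affine hull S}"
  have "affine hull S \<subseteq> {p. Poly_Mapping.keys p \<subseteq> A}"
    using S by (intro hull_minimal subspace_imp_affine subspace_keys_subset)
  then have "affine hull S \<subseteq> span B"
    by (auto simp: B_def intro: keys_subset_imp_in_span)
  then have V: "V \<subseteq> span B"
    by (auto simp: V_def intro!: span_diff)
  have B: "finite B" "card B \<le> card A"
    using \<open>finite A\<close> by (auto simp: B_def card_image_le)
  have "dim V \<le> card B"
    using V B(1) by (rule real_vector.dim_le_card)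
  \<comment> \<open>The finite set \<open>B\<close> spans \<open>V\<close>, which rules out the
    value \<infinity>.\<close>
  moreover have "affine_hull_dim S = enat (dim V)"
    using V B(1) unfolding affine_hull_dim_def V_def[symmetric] Let_def by auto
  ultimately show ?thesis
    using B(2) by simp
qed

section \<open>Counting exponent vectors\<close>

lemma bounded_exponents:
  defines "E \<equiv> \<lambda>k. {a :: nat ^ 'n::finite. (\<Sum>i\<in>UNIV. a $ i) \<le> k}"
  shows "finite (E k)" and "card (E k) \<le> (CARD('n) + k) choose k"
proof -
  \<comment> \<open>An enumeration of the coordinates turns vectors into lists, for which stars and
    bars is available as \<open>card_length_sum_list\<close>.\<close>
  obtain xs :: "'n list" where xs: "set xs = UNIV" "distinct xs"
    using finite_distinct_list[of "UNIV :: 'n set"] by auto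
  then have len: "length xs = CARD('n)"
    using distinct_card by fastforce
  define L where "L = {l :: nat list. length l = CARD('n) + 1 \<and> sum_list l = k}"
  \<comment> \<open>a slack entry turns the inequality into an equation\<close>
  define F where "F = (\<lambda>a :: nat ^ 'n. map (($) a) xs @ [k - (\<Sum>i\<in>UNIV. a $ i)])"
  have card_L: "card L = (CARD('n) + k) choose k"
    unfolding L_def by (subst card_length_sum_list) (simp add: add.commute)
  \<comment> \<open>Infinite sets have \<open>card\<close> 0, so a positive value yields
    finiteness.\<close>
  then have "card L > 0"
    by simp
  then have "finite L"
    by (rule card_ge_0_finite)
  moreover have inj: "inj_on F (E k)"
    by (rule inj_onI) (auto simp: F_def vec_eq_iff xs)
  moreover have sub: "F ` E k \<subseteq> L"
  proof -
    have "sum_list (map (($) a) xs) = (\<Sum>i\<in>UNIV. a $ i)" for a :: "nat ^ 'n"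
      using xs sum_list_distinct_conv_sum_set by metis
    then show ?thesis
      by (auto simp: F_def L_def E_def len)
  qed
  ultimately show "finite (E k)" and "card (E k) \<le> (CARD('n) + k) choose k"
    using card_inj_on_le[OF inj sub] card_L by (auto intro: inj_on_finite)
qed

text \<open>Every even vector of degree at most 2k is twice a vector of degree at most k, so the
  previous count applies.\<close>

lemma bounded_even_exponents:
  defines "D \<equiv> \<lambda>k. {a :: nat ^ 'n::finite. (\<Sum>i\<in>UNIV. a $ i) \<le> 2 * k \<and> (\<forall>i. even (a $ i))}"
  shows "finite (D k)" and "card (D k) \<le> (CARD('n) + k) choose k"
proof -
  let ?E = "{a :: nat ^ 'n. (\<Sum>i\<in>UNIV. a $ i) \<le> k}"
  have sub: "D k \<subseteq> (\<lambda>a. \<chi> i. 2 * a $ i) ` ?E"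
  proof
    fix a assume a: "a \<in> D k"
    define b where "b = (\<chi> i. a $ i div 2)"
    have "a = (\<chi> i. 2 * b $ i)"
      using a by (simp add: D_def b_def vec_eq_iff)
    moreover from this have "(\<Sum>i\<in>UNIV. a $ i) = 2 * (\<Sum>i\<in>UNIV. b $ i)"
      by (simp add: sum_distrib_left)
    then have "b \<in> ?E"
      using a by (simp add: D_def)
    ultimately show "a \<in> (\<lambda>a. \<chi> i. 2 * a $ i) ` ?E"
      by blast
  qed
  show "finite (D k)"
    by (rule finite_subset[OF sub]) (rule finite_imageI[OF bounded_exponents(1)])
  have "card (D k) \<le> card ?E"
    by (rule surj_card_le[OF bounded_exponents(1) sub])
  also note bounded_exponents(2)
  finally show "card (D k) \<le> (CARD('n) + k) choose k" .
qed

section \<open>Evaluation of polynomials\<close>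

text \<open>Exponents outside the support contribute 0. A common index set is needed for linearity,
  since cancellation or scaling by 0 can shrink the support.\<close>

lemma poly_eval_superset:
  assumes "finite A" "Poly_Mapping.keys p \<subseteq> A"
  shows "poly_eval p x = (\<Sum>a\<in>A. Poly_Mapping.lookup p a * (\<Prod>i\<in>UNIV. (x $ i) ^ (a $ i)))"
  unfolding poly_eval_def using assms
  by (intro sum.mono_neutral_left) (auto simp: in_keys_iff)

lemma poly_eval_zero [simp]: "poly_eval 0 x = 0"
  by (simp add: poly_eval_def)

lemma poly_eval_add: "poly_eval (p + q) x = poly_eval p x + poly_eval q x"
proof -
  let ?A = "Poly_Mapping.keys p \<union> Poly_Mapping.keys q"
  have "finite ?A" "Poly_Mapping.keys (p + q) \<subseteq> ?A"
    by (simp_all add: Poly_Mapping.keys_add)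
  then show ?thesis
    by (simp add: poly_eval_superset[of ?A] lookup_add sum.distrib distrib_right)
qed

lemma poly_eval_scaleR: "poly_eval (c *\<^sub>R p) x = c * poly_eval p x"
proof -
  have "Poly_Mapping.keys (c *\<^sub>R p) \<subseteq> Poly_Mapping.keys p"
    by (auto simp: in_keys_iff scaleR_poly_mapping.rep_eq)
  then show ?thesis
    by (simp add: poly_eval_superset[of "Poly_Mapping.keys p"] scaleR_poly_mapping.rep_eq
        sum_distrib_left mult.assoc)
qed

lemma poly_eval_sum: "poly_eval (\<Sum>j\<in>J. f j) x = (\<Sum>j\<in>J. poly_eval (f j) x)"
  by (induction J rule: infinite_finite_induct) (simp_all add: poly_eval_add)

lemma poly_eval_single:
  "poly_eval (Poly_Mapping.single a c) x = c * (\<Prod>i\<in>UNIV. (x $ i) ^ (a $ i))"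
  by (subst poly_eval_superset[of "{a}"]) auto

lemma sum_exponents_le_total_degree:
  assumes "a \<in> Poly_Mapping.keys p"
  shows "(\<Sum>i\<in>UNIV. a $ i) \<le> total_degree p"
  unfolding total_degree_def using assms by (intro Max_ge) auto

section \<open>Vanishing on sign vectors forces even exponents\<close>

lemma circuit_vanishing_on_signs_even:
  fixes f :: "'n::finite rpoly"
  assumes "circuit_polynomial f"
    and van: "\<And>s. (\<forall>i. s $ i \<in> {1, -1}) \<Longrightarrow> poly_eval f s = 0"
    and "a \<in> Poly_Mapping.keys f"
  shows "even (a $ i)"
proof -
  obtain r :: nat and \<alpha> :: "nat \<Rightarrow> nat ^ 'n" and \<beta> :: "nat ^ 'n" and c c\<^sub>\<beta>
    where f: "f = (\<Sum>j\<le>r. Poly_Mapping.single (\<alpha> j) (c j)) + Poly_Mapping.single \<beta> c\<^sub>\<beta>"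
      and c: "\<forall>j\<le>r. c j > 0" and \<alpha>: "\<forall>j\<le>r. \<forall>i. even (\<alpha> j $ i)"
    using assms(1) unfolding circuit_polynomial_def by (elim exE conjE)
  have eval: "(\<Sum>j\<le>r. c j) + c\<^sub>\<beta> * (\<Prod>i\<in>UNIV. (s $ i) ^ (\<beta> $ i)) = 0"
    if s: "\<forall>i. s $ i \<in> {1, -1}" for s :: "real ^ 'n"
  proof -
    have "(\<Prod>i\<in>UNIV. (s $ i) ^ (\<alpha> j $ i)) = 1" if "j \<le> r" for j
    proof (rule prod.neutral, rule ballI)
      fix i
      have "s $ i = 1 \<or> s $ i = -1" "even (\<alpha> j $ i)"
        using s \<alpha> that by auto
      then show "(s $ i) ^ (\<alpha> j $ i) = 1"
        by auto
    qed
    then have "poly_eval f s = (\<Sum>j\<le>r. c j) + c\<^sub>\<beta> * (\<Prod>i\<in>UNIV. (s $ i) ^ (\<beta> $ i))"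
      by (simp add: f poly_eval_add poly_eval_sum poly_eval_single)
    then show ?thesis
      using van[OF s] by simp
  qed
  have pos: "(\<Sum>j\<le>r. c j) > 0"
    using c by (intro sum_pos) auto
  have \<beta>: "even (\<beta> $ k)" for k
  proof (rule ccontr)
    assume odd: "odd (\<beta> $ k)"
    \<comment> \<open>Flipping only coordinate \<open>k\<close> gives the \<beta>-monomial the value
      -1, while at the all-ones vector it is 1. Adding the two equations makes the sum of the
      \<open>c j\<close> zero.\<close>
    define s :: "real ^ 'n" where "s = (\<chi> i. if i = k then -1 else 1)"
    have "(\<Prod>i\<in>UNIV. (s $ i) ^ (\<beta> $ i)) = (\<Prod>i\<in>UNIV. if i = k then -1 else 1)"
      using odd by (intro prod.cong) (auto simp: s_def)
    then have "(\<Sum>j\<le>r. c j) - c\<^sub>\<beta> = 0"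
      using eval[of s] by (simp add: s_def)
    moreover have "(\<Sum>j\<le>r. c j) + c\<^sub>\<beta> = 0"
      using eval[of "\<chi> i. 1"] by simp
    ultimately show False
      using pos by simp
  qed
  \<comment> \<open>Terms of \<open>f\<close> may share an exponent and cancel; arguing in a
    subspace avoids computing the support exactly.\<close>
  let ?W = "{p :: 'n rpoly. Poly_Mapping.keys p \<subseteq> {a. \<forall>i. even (a $ i)}}"
  have "f \<in> ?W"
    unfolding f using \<alpha> \<beta>
    by (intro subspace_add[OF subspace_keys_subset] subspace_sum[OF subspace_keys_subset]) auto
  then show ?thesis
    using assms(3) by blast
qed

lemma sonc_vanishing_on_signs_even:
  fixes p :: "'n::finite rpoly"
  assumes "p \<in> sonc_face k {s. \<forall>i. s $ i \<in> {1, -1}}" and "a \<in> Poly_Mapping.keys p"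
  shows "even (a $ i)"
proof -
  obtain m :: nat and \<mu> :: "nat \<Rightarrow> real" and f :: "nat \<Rightarrow> 'n rpoly"
    where f: "\<forall>i<m. \<mu> i \<ge> 0 \<and> circuit_polynomial (f i) \<and> nonneg_polynomial (f i)"
      and p: "p = (\<Sum>i<m. \<mu> i *\<^sub>R f i)"
    using assms(1) unfolding sonc_face_def sonc_cone_def by blast
  let ?W = "{p :: 'n rpoly. Poly_Mapping.keys p \<subseteq> {a. \<forall>i. even (a $ i)}}"
  \<comment> \<open>Nothing is known about the zeros of a summand of weight 0, but its scaled
    version is the zero polynomial. With positive weight, it vanishes wherever the sum of
    nonnegative terms does.\<close>
  have "\<mu> l *\<^sub>R f l \<in> ?W" if l: "l < m" for l
  proof (cases "\<mu> l = 0")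
    case False
    have "poly_eval (f l) s = 0" if s: "\<forall>i. s $ i \<in> {1, -1}" for s
    proof -
      have "(\<Sum>i<m. \<mu> i * poly_eval (f i) s) = 0"
        using assms(1) s by (auto simp: sonc_face_def p poly_eval_sum poly_eval_scaleR)
      then have "\<mu> l * poly_eval (f l) s = 0"
        using f l by (subst (asm) sum_nonneg_eq_0_iff) (auto simp: nonneg_polynomial_def)
      then show ?thesis
        using False by simp
    qed
    then have "f l \<in> ?W"
      using circuit_vanishing_on_signs_even f l by blast
    then show ?thesis
      by (rule subspace_scale[OF subspace_keys_subset])
  qed simp
  then have "p \<in> ?W"
    unfolding p by (intro subspace_sum[OF subspace_keys_subset]) auto
  then show ?thesis
    using assms(2) by blast
qed

text \<open>A sign vector is determined by the set of its coordinates equal to 1. The upper bound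
  suffices to identify a subset of size \<open>2 ^ CARD('n)\<close> with the whole cube.\<close>

lemma sign_vectors:
  defines "Q \<equiv> {s :: real ^ 'n::finite. \<forall>i. s $ i \<in> {1, -1}}"
  shows "finite Q" and "card Q \<le> 2 ^ CARD('n)"
proof -
  have inj: "inj_on (\<lambda>s. {i. s $ i = 1}) Q"
  proof (rule inj_onI)
    fix s t assume st: "s \<in> Q" "t \<in> Q" "{i. s $ i = 1} = {i. t $ i = 1}"
    have "s $ i = t $ i" for i
    proof -
      have "s $ i = 1 \<or> s $ i = -1" "t $ i = 1 \<or> t $ i = -1" "s $ i = 1 \<longleftrightarrow> t $ i = 1"
        using st by (auto simp: Q_def)
      then show ?thesis
        by auto
    qed
    then show "s = t"
      by (simp add: vec_eq_iff)
  qed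
  show "finite Q"
    by (rule inj_on_finite[OF inj subset_UNIV]) simp
  have "card Q \<le> card (Pow (UNIV :: 'n set))"
    by (rule card_inj_on_le[OF inj]) auto
  then show "card Q \<le> 2 ^ CARD('n)"
    by (simp add: card_Pow)
qed

theorem proposition5p1:
  fixes \<Gamma> :: "(real ^ 'n) set" and d :: nat
  assumes "d \<ge> 1"
    and "\<Gamma> \<subseteq> {s. \<forall>i. s $ i \<in> {1, -1}}"
  shows "(card \<Gamma> = 2 ^ CARD('n) \<longrightarrow>
            affine_hull_dim (sonc_face (2 * d) \<Gamma>) \<le> enat ((CARD('n) + d) choose d)) \<and>
         (card \<Gamma> = 2 ^ (CARD('n) - 1) \<longrightarrow>
            affine_hull_dim (sonc_face (2 * d) \<Gamma>) \<le> enat ((CARD('n) + 2 * d) choose (2 * d)))"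
proof -
  \<comment> \<open>The cone bounds the degree of the sum \<open>p\<close> itself, so the degrees of
    the circuit summands do not enter.\<close>
  have degree: "(\<Sum>i\<in>UNIV. a $ i) \<le> 2 * d"
    if "p \<in> sonc_face (2 * d) \<Gamma>" "a \<in> Poly_Mapping.keys p" for p a
    using that sum_exponents_le_total_degree[of a p]
    by (simp add: sonc_face_def sonc_cone_def)
  show ?thesis
  proof (intro conjI impI)
    assume "card \<Gamma> = 2 ^ CARD('n)"
    then have \<Gamma>: "\<Gamma> = {s. \<forall>i. s $ i \<in> {1, -1}}"
      using sign_vectors[where 'n = 'n] assms(2) by (intro card_seteq) auto
    let ?D = "{a :: nat ^ 'n. (\<Sum>i\<in>UNIV. a $ i) \<le> 2 * d \<and> (\<forall>i. even (a $ i))}"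
    have "sonc_face (2 * d) \<Gamma> \<subseteq> {p. Poly_Mapping.keys p \<subseteq> ?D}"
      using degree sonc_vanishing_on_signs_even unfolding \<Gamma> by blast
    from affine_hull_dim_le_card[OF bounded_even_exponents(1) this]
    show "affine_hull_dim (sonc_face (2 * d) \<Gamma>) \<le> enat ((CARD('n) + d) choose d)"
      by (rule order_trans) (simp add: bounded_even_exponents(2))
  next
    let ?E = "{a :: nat ^ 'n. (\<Sum>i\<in>UNIV. a $ i) \<le> 2 * d}"
    have "sonc_face (2 * d) \<Gamma> \<subseteq> {p. Poly_Mapping.keys p \<subseteq> ?E}"
      using degree by blast
    from affine_hull_dim_le_card[OF bounded_exponents(1) this]
    show "affine_hull_dim (sonc_face (2 * d) \<Gamma>) \<le> enat ((CARD('n) + 2 * d) choose (2 * d))"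
      by (rule order_trans) (simp add: bounded_exponents(2))
  qed
qed

end
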